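(* Let $(X,d,\mu)$ be a metric measure space in which every porous set has measure zero. Then for $\mu$-almost every $x_0\in X$ the following holds: whenever $g\colon X\to\mathbb{R}$ is a Lipschitz function such that \[\operatorname*{aplim}_{x\to x_0}\frac{g(x)}{d(x,x_0)}=0,\] then \[\lim_{x\to x_0}\frac{g(x)}{d(x,x_0)}=0.\]
   Context: A metric measure space $(X,d,\mu)$ is a complete separable metric space $(X,d)$ equipped with a locally finite Borel measure $\mu$. For almost every $x_0\in X$ one has $\mu(B(x_0,r))>0$ for all $r>0$. A function $q$ has approximate limit $l\in\mathbb{R}$ at $x_0\in X$, written $\operatorname*{aplim}_{x\to x_0}q(x)=l$, if for every $\varepsilon>0$ \[\lim_{r\downarrow 0}\frac{\mu\{x\in B(x_0,r):|q(x)-l|>\varepsilon\}}{\mu(B(x_0,r))}=0.\] For the quotient $g(x)/d(x,x_0)$ the point $x=x_0$, where it is undefined, is disregarded. For $\eta>0$, a set $S\subset X$ is $\eta$-porous at $x_0\in S$ if there exist $x_n\in X$ with $x_n\to x_0$ and $d(x_n,S)>\eta\, d(x_n,x_0)$ for all $n$. $S$ is porous if for each $x_0\in S$ there is some $\eta>0$ (possibly depending on $x_0$) such that $S$ is $\eta$-porous at $x_0$. *)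

theory Defs
  imports "HOL-Analysis.Analysis"
begin

text \<open>The class \<open>polish_space\<close> fixes a complete metric inducing a second countable topology,
  i.e. it is the class of complete separable metric spaces.\<close>

definition metric_measure_space :: "'a::polish_space measure \<Rightarrow> bool" where
  "metric_measure_space M \<longleftrightarrow>
     sets M = sets borel \<and> (\<forall>x. \<exists>r>0. emeasure M (ball x r) < \<infinity>)"

text \<open>The function \<open>q\<close> is regarded as defined on \<open>D\<close> only; points outside \<open>D\<close> are disregarded.
  The real-valued \<^const>\<open>measure\<close> sends sets of infinite measure and non-measurable sets to 0.
  The definition is therefore meant for locally finite \<open>M\<close>, where balls of small radius around
  \<open>x0\<close> have finite measure, and for \<open>q\<close> measurable on the Borel set \<open>D\<close>.\<close>

definition has_aplim ::
    "'a::metric_space measure \<Rightarrow> 'a set \<Rightarrow> ('a \<Rightarrow> real) \<Rightarrow> real \<Rightarrow> 'a \<Rightarrow> bool" where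
  "has_aplim M D q l x0 \<longleftrightarrow>
     (\<forall>\<epsilon>>0. ((\<lambda>r. measure M {x \<in> ball x0 r \<inter> D. \<bar>q x - l\<bar> > \<epsilon>} / measure M (ball x0 r))
               \<longlongrightarrow> 0) (at_right 0))"

definition porous_at :: "real \<Rightarrow> 'a::metric_space set \<Rightarrow> 'a \<Rightarrow> bool" where
  "porous_at \<eta> S x0 \<longleftrightarrow> x0 \<in> S \<and>
     (\<exists>x. x \<longlonglongrightarrow> x0 \<and> (\<forall>n. infdist (x n) S > \<eta> * dist (x n) x0))"

definition porous :: "'a::metric_space set \<Rightarrow> bool" where
  "porous S \<longleftrightarrow> (\<forall>x0\<in>S. \<exists>\<eta>>0. porous_at \<eta> S x0)"

text \<open>Porous sets need not be Borel, so measure zero means being contained in a Borel null set.\<close>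

definition measure_zero :: "'a measure \<Rightarrow> 'a set \<Rightarrow> bool" where
  "measure_zero M S \<longleftrightarrow> (\<exists>N\<in>null_sets M. S \<subseteq> N)"

end

theory Submission
  imports Defs
begin

text \<open>
  If \<open>g\<close> is Lipschitz and \<open>g x / dist x x0\<close> has approximate limit \<open>0\<close> at \<open>x0\<close> but does not converge
  to \<open>0\<close>, then there are points \<open>y\<close> arbitrarily close to \<open>x0\<close> with
  \<open>\<bar>g y\<bar> \<ge> \<epsilon> * dist y x0\<close>.  By the Lipschitz bound the quotient stays away from \<open>0\<close> on the whole ball
  around \<open>y\<close> of radius \<open>\<delta> * dist y x0\<close>, where \<open>\<delta>\<close> depends only on \<open>\<epsilon>\<close> and the Lipschitz constant.
  The approximate limit then forces such balls to carry a vanishing proportion of the mass of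
  \<open>ball x0 (2 * dist y x0)\<close>.  The set of points \<open>x0\<close> with this property no longer mentions \<open>g\<close>, which
  deals with all Lipschitz functions simultaneously, and it increases as \<open>\<delta>\<close> decreases, so it
  suffices to show that it is null for each \<open>\<delta>\<close> of the form \<open>1 / (n + 2)\<close>.

  At a fixed scale, a Vitali selection among the balls \<open>ball x (2 * dist y x)\<close> yields
  disjoint ones that come close to every point of the set.  The union of the
  corresponding small balls around the points \<open>y\<close> has as small a measure as desired, since each is
  negligible compared with the selected ball that contains it.  Deleting these unions at all scales
  \<open>2\<^sup>-\<^sup>k\<close> from some index on leaves a porous set, because each of its points sees a proportionally
  large deleted ball at every scale.  So what is left is null by hypothesis, and by the
  Borel-Cantelli lemma almost every point lies in only finitely many of the deleted sets.
\<close>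

section \<open>Vitali selection\<close>

text \<open>
  The \<open>5r\<close> covering argument, for sets \<open>A i\<close> with an arbitrary bounded size \<open>r i\<close>.  Zorn's lemma is
  applied to the disjoint subfamilies \<open>C\<close> such that every \<open>i\<close> that meets \<open>C\<close> meets a member of at
  least half its size.  If some \<open>i\<close> met no member of a maximal such \<open>C\<close>, one of nearly largest size
  among those could be added.
\<close>

lemma ex_disjoint_subfamily_meeting_all:
  fixes A :: "'i \<Rightarrow> 'b set" and r :: "'i \<Rightarrow> real"
  assumes nonempty: "\<And>i. i \<in> I \<Longrightarrow> A i \<noteq> {}"
    and pos: "\<And>i. i \<in> I \<Longrightarrow> 0 < r i" and bound: "\<And>i. i \<in> I \<Longrightarrow> r i \<le> B"
  obtains C where "C \<subseteq> I" "disjoint_family_on A C"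
    "\<And>i. i \<in> I \<Longrightarrow> \<exists>j\<in>C. A i \<inter> A j \<noteq> {} \<and> r i \<le> 2 * r j"
proof -
  define Q where "Q i C \<longleftrightarrow> (\<exists>j\<in>C. A i \<inter> A j \<noteq> {}) \<longrightarrow> (\<exists>j\<in>C. A i \<inter> A j \<noteq> {} \<and> r i \<le> 2 * r j)"
    for i C
  define \<Omega> where "\<Omega> = {C. C \<subseteq> I \<and> disjoint_family_on A C \<and> (\<forall>i\<in>I. Q i C)}"
  have "\<exists>C\<in>\<Omega>. \<forall>D\<in>\<Omega>. C \<subseteq> D \<longrightarrow> D = C"
  proof (rule subset_Zorn')
    fix \<C> assume chain: "subset.chain \<Omega> \<C>"
    then have sub: "\<C> \<subseteq> \<Omega>" and total: "\<And>X Y. X \<in> \<C> \<Longrightarrow> Y \<in> \<C> \<Longrightarrow> X \<subseteq> Y \<or> Y \<subseteq> X"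
      by (auto simp: subset_chain_def)
    have "disjoint_family_on A (\<Union>\<C>)"
      unfolding disjoint_family_on_def
    proof (intro ballI impI)
      fix i j assume "i \<in> \<Union>\<C>" "j \<in> \<Union>\<C>" "i \<noteq> j"
      then obtain X where "X \<in> \<C>" "i \<in> X" "j \<in> X"
        using total by blast
      with sub \<open>i \<noteq> j\<close> show "A i \<inter> A j = {}"
        by (auto simp: \<Omega>_def disjoint_family_on_def)
    qed
    moreover have "Q i (\<Union>\<C>)" if "i \<in> I" for i
      unfolding Q_def
    proof
      assume "\<exists>j\<in>\<Union>\<C>. A i \<inter> A j \<noteq> {}"
      then obtain X where X: "X \<in> \<C>" "\<exists>j\<in>X. A i \<inter> A j \<noteq> {}"
        by blast
      then have "Q i X"
        using sub that by (auto simp: \<Omega>_def)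
      with X show "\<exists>j\<in>\<Union>\<C>. A i \<inter> A j \<noteq> {} \<and> r i \<le> 2 * r j"
        unfolding Q_def by blast
    qed
    ultimately show "\<Union>\<C> \<in> \<Omega>"
      using sub by (auto simp: \<Omega>_def)
  qed
  then obtain C where C: "C \<in> \<Omega>" and maximal: "\<And>D. D \<in> \<Omega> \<Longrightarrow> C \<subseteq> D \<Longrightarrow> D = C"
    by blast
  have "\<exists>j\<in>C. A i \<inter> A j \<noteq> {}" if "i \<in> I" for i
  proof (rule ccontr)
    assume no: "\<not> ?thesis"
    define J where "J = {i \<in> I. \<forall>j\<in>C. A i \<inter> A j = {}}"
    have "i \<in> J"
      using that no by (auto simp: J_def)
    have bdd: "bdd_above (r ` J)"
      using bound by (auto simp: J_def bdd_above_def)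
    have "r i \<le> (SUP i\<in>J. r i)"
      using \<open>i \<in> J\<close> bdd by (rule cSUP_upper)
    with pos[OF that] have "(SUP i\<in>J. r i) / 2 < (SUP i\<in>J. r i)"
      by linarith
    then obtain k where k: "k \<in> J" "(SUP i\<in>J. r i) / 2 < r k"
      using \<open>i \<in> J\<close> less_cSUP_iff[OF _ bdd] by blast
    have large: "r l \<le> 2 * r k" if "l \<in> J" for l
      using cSUP_upper[OF that bdd] k(2) by linarith
    have "Q l (insert k C)" if "l \<in> I" for l
    proof (cases "l \<in> J")
      case True
      then show ?thesis
        using large[OF True] by (auto simp: Q_def J_def)
    next
      case False
      then show ?thesis
        using C that by (auto simp: Q_def J_def \<Omega>_def)
    qed
    moreover have "disjoint_family_on A (insert k C)"
      using C k(1) unfolding \<Omega>_def J_def disjoint_family_on_def by blast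
    ultimately have "insert k C \<in> \<Omega>"
      using C k(1) by (auto simp: \<Omega>_def J_def)
    then have "k \<in> C"
      using maximal by blast
    with k(1) have "A k = {}"
      by (auto simp: J_def)
    with nonempty k(1) show False
      by (auto simp: J_def)
  qed
  with C show thesis
    by (intro that[of C]) (auto simp: \<Omega>_def Q_def)
qed

lemma countable_disjoint_family_open:
  fixes A :: "'i \<Rightarrow> 'a::second_countable_topology set"
  assumes disj: "disjoint_family_on A C"
    and "\<And>i. i \<in> C \<Longrightarrow> open (A i)" and nonempty: "\<And>i. i \<in> C \<Longrightarrow> A i \<noteq> {}"
  shows "countable C"
proof (rule countable_image_inj_on)
  show "countable (A ` C)"
  proof (rule countable_disjoint_open_subsets)
    show "pairwise disjnt (A ` C)"
      using disj by (force simp: pairwise_def disjnt_def disjoint_family_on_def)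
  qed (use assms in auto)
  show "inj_on A C"
    using disj nonempty by (fastforce simp: inj_on_def disjoint_family_on_def)
qed

section \<open>Points with relatively negligible balls nearby\<close>

text \<open>
  The property of \<open>x\<close> that is left of a failing Lipschitz function \<open>g\<close>.  The inequality between the
  measures is non-strict, so that a point with a null ball around it has the property as soon as it is
  not isolated.  At such a point every approximate limit holds vacuously, because \<open>0 / 0 = 0\<close>; it is
  thus treated like any other point, without a separate argument for the support of the measure.
\<close>

definition has_negligible_nearby_balls ::
    "'a::metric_space measure \<Rightarrow> real \<Rightarrow> 'a \<Rightarrow> bool" where
  "has_negligible_nearby_balls M \<delta> x \<longleftrightarrow>
     (\<forall>e>0. \<forall>s>0. \<exists>y. 0 < dist y x \<and> dist y x < s \<and>
        emeasure M (ball y (\<delta> * dist y x)) \<le> ennreal e * emeasure M (ball x (2 * dist y x)))"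

text \<open>
  One scale of the construction.  The set \<open>V\<close> is the union of the balls
  \<open>ball (y i) (\<delta> * dist (y i) i)\<close> over the \<open>i\<close> for which \<open>ball i (2 * dist (y i) i)\<close> is selected.  For
  \<open>\<delta> \<le> 1\<close> each of the former lies in the latter, so all measures add up.  A point \<open>x\<close> whose own ball
  meets the selected one around \<open>i\<close> with at least half the radius satisfies
  \<open>dist i x < 6 * dist (y i) i\<close>, whence the constant \<open>7\<close>.
\<close>

lemma ex_small_open_set_with_holes_near:
  fixes M :: "'a::{metric_space, second_countable_topology} measure"
  assumes borel: "sets M = sets borel" and "open U"
    and \<delta>: "0 < \<delta>" "\<delta> \<le> 1" and "0 < e" "0 < s"
  obtains V where "open V" "emeasure M V \<le> ennreal e * emeasure M U"
    "\<And>x. x \<in> U \<Longrightarrow> has_negligible_nearby_balls M \<delta> x \<Longrightarrow>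
       \<exists>y d. 0 < d \<and> d < s \<and> ball y (\<delta> * d) \<subseteq> V \<and> dist y x < 7 * d"
proof -
  define E where "E = {x \<in> U. has_negligible_nearby_balls M \<delta> x}"
  have "\<exists>y. 0 < dist y x \<and> dist y x < s \<and> ball x (2 * dist y x) \<subseteq> U \<and>
      emeasure M (ball y (\<delta> * dist y x)) \<le> ennreal e * emeasure M (ball x (2 * dist y x))"
    if "x \<in> E" for x
  proof -
    have "x \<in> U" and nearby: "has_negligible_nearby_balls M \<delta> x"
      using that by (auto simp: E_def)
    obtain t where t: "0 < t" "ball x t \<subseteq> U"
      using \<open>open U\<close> \<open>x \<in> U\<close> by (rule openE)
    then have "0 < min s (t / 2)"
      using \<open>0 < s\<close> by simp
    from nearby[unfolded has_negligible_nearby_balls_def, rule_format, OF \<open>0 < e\<close> this]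
    obtain y where y: "0 < dist y x" "dist y x < min s (t / 2)"
      "emeasure M (ball y (\<delta> * dist y x)) \<le> ennreal e * emeasure M (ball x (2 * dist y x))"
      by blast
    moreover have "ball x (2 * dist y x) \<subseteq> ball x t"
      using y(2) by (intro subset_ball) simp
    ultimately show ?thesis
      using t(2) by (intro exI[of _ y]) auto
  qed
  then obtain y where y: "\<And>x. x \<in> E \<Longrightarrow> 0 < dist (y x) x" "\<And>x. x \<in> E \<Longrightarrow> dist (y x) x < s"
      "\<And>x. x \<in> E \<Longrightarrow> ball x (2 * dist (y x) x) \<subseteq> U"
      "\<And>x. x \<in> E \<Longrightarrow> emeasure M (ball (y x) (\<delta> * dist (y x) x))
          \<le> ennreal e * emeasure M (ball x (2 * dist (y x) x))"
    by metis
  define big where "big x = ball x (2 * dist (y x) x)" for x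
  define hole where "hole x = ball (y x) (\<delta> * dist (y x) x)" for x
  have big: "big x \<noteq> {}" "0 < 2 * dist (y x) x" "2 * dist (y x) x \<le> 2 * s" if "x \<in> E" for x
    using y(1,2)[OF that] by (auto simp: big_def)
  obtain C where C: "C \<subseteq> E" "disjoint_family_on big C"
    "\<And>x. x \<in> E \<Longrightarrow> \<exists>i\<in>C. big x \<inter> big i \<noteq> {} \<and> 2 * dist (y x) x \<le> 2 * (2 * dist (y i) i)"
    using ex_disjoint_subfamily_meeting_all[of E big "\<lambda>x. 2 * dist (y x) x" "2 * s", OF big]
    by blast
  have "countable C"
    using C(1,2) big(1) by (intro countable_disjoint_family_open[of big]) (auto simp: big_def)
  have hole_subset: "hole x \<subseteq> big x" for x
  proof
    fix z assume "z \<in> hole x"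
    then have "dist (y x) z < \<delta> * dist (y x) x"
      by (simp add: hole_def)
    also have "\<dots> \<le> dist (y x) x"
      using \<delta> by (simp add: mult_left_le_one_le)
    finally show "z \<in> big x"
      using dist_triangle[of x z "y x"] by (simp add: big_def dist_commute)
  qed
  have disj: "disjoint_family_on hole C"
    using C(2) hole_subset unfolding disjoint_family_on_def by blast
  have meas: "hole x \<in> sets M" "big x \<in> sets M" for x
    by (simp_all add: borel hole_def big_def)
  have "emeasure M (\<Union>x\<in>C. hole x) = (\<integral>\<^sup>+x. emeasure M (hole x) \<partial>count_space C)"
    using meas(1) \<open>countable C\<close> disj by (rule emeasure_UN_countable)
  also have "\<dots> \<le> (\<integral>\<^sup>+x. ennreal e * emeasure M (big x) \<partial>count_space C)"
    using C(1) y(4) by (intro nn_integral_mono) (auto simp: hole_def big_def)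
  also have "\<dots> = ennreal e * (\<integral>\<^sup>+x. emeasure M (big x) \<partial>count_space C)"
    by (intro nn_integral_cmult) simp
  also have "(\<integral>\<^sup>+x. emeasure M (big x) \<partial>count_space C) = emeasure M (\<Union>x\<in>C. big x)"
    using meas(2) \<open>countable C\<close> C(2) by (rule emeasure_UN_countable[symmetric])
  also have "\<dots> \<le> emeasure M U"
    using C(1) y(3) \<open>open U\<close> by (intro emeasure_mono) (auto simp: borel big_def)
  finally have measure_V: "emeasure M (\<Union>x\<in>C. hole x) \<le> ennreal e * emeasure M U"
    by (simp add: mult_left_mono)
  show thesis
  proof (rule that[OF _ measure_V])
    show "open (\<Union>x\<in>C. hole x)"
      by (auto simp: hole_def)
    fix x assume "x \<in> U" "has_negligible_nearby_balls M \<delta> x"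
    then have "x \<in> E"
      by (simp add: E_def)
    then obtain i z where i: "i \<in> C" "z \<in> big x" "z \<in> big i"
        "2 * dist (y x) x \<le> 2 * (2 * dist (y i) i)"
      using C(3) by blast
    have "dist (y i) x \<le> dist (y i) i + (dist i z + dist x z)"
      using dist_triangle[of "y i" x i] dist_triangle2[of i x z] by linarith
    with i have "dist (y i) x < 7 * dist (y i) i"
      by (auto simp: big_def)
    with i(1) C(1) y(1,2) show
      "\<exists>y d. 0 < d \<and> d < s \<and> ball y (\<delta> * d) \<subseteq> (\<Union>x\<in>C. hole x) \<and> dist y x < 7 * d"
      by (intro exI[of _ "y i"] exI[of _ "dist (y i) i"]) (auto simp: hole_def)
  qed
qed

text \<open>
  The ratio of the radius \<open>\<delta> * d\<close> of a hole to its distance from \<open>x\<close> exceeds \<open>\<delta> / c\<close>, which is the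
  porosity constant.
\<close>

lemma porousI:
  fixes S :: "'a::metric_space set"
  assumes "0 < \<delta>" "0 < c" "\<sigma> \<longlonglongrightarrow> 0"
    and holes: "\<And>x n. x \<in> S \<Longrightarrow>
      \<exists>y d. 0 < d \<and> d < \<sigma> n \<and> ball y (\<delta> * d) \<inter> S = {} \<and> dist y x < c * d"
  shows "porous S"
  unfolding porous_def
proof
  fix x assume "x \<in> S"
  with holes obtain y d where yd: "\<And>n::nat. 0 < d n" "\<And>n. d n < \<sigma> n"
      "\<And>n. ball (y n) (\<delta> * d n) \<inter> S = {}" "\<And>n. dist (y n) x < c * d n"
    by metis
  have "y \<longlonglongrightarrow> x"
  proof (rule metric_tendsto_imp_tendsto[where f = "\<lambda>n. c * \<sigma> n" and a = 0])
    show "(\<lambda>n. c * \<sigma> n) \<longlonglongrightarrow> 0"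
      using tendsto_mult_left[OF \<open>\<sigma> \<longlonglongrightarrow> 0\<close>, of c] by simp
    have "dist (y n) x \<le> \<bar>c * \<sigma> n\<bar>" for n
      using yd(4)[of n] mult_strict_left_mono[OF yd(2)[of n] \<open>0 < c\<close>] by linarith
    then show "\<forall>\<^sub>F n in sequentially. dist (y n) x \<le> dist (c * \<sigma> n) 0"
      by simp
  qed
  moreover have "infdist (y n) S > \<delta> / c * dist (y n) x" for n
  proof -
    have "\<delta> / c * dist (y n) x < \<delta> / c * (c * d n)"
      using yd(4)[of n] \<open>0 < \<delta>\<close> \<open>0 < c\<close> by (intro mult_strict_left_mono) auto
    also have "\<dots> = \<delta> * d n"
      using \<open>0 < c\<close> by simp
    also have "\<dots> \<le> infdist (y n) S"
      unfolding infdist_notempty[OF ex_in_conv[THEN iffD1, OF exI, OF \<open>x \<in> S\<close>]]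
      using \<open>x \<in> S\<close> yd(3)[of n] by (intro cINF_greatest) (force simp: not_less)+
    finally show ?thesis .
  qed
  ultimately show "\<exists>\<eta>>0. porous_at \<eta> S x"
    using \<open>x \<in> S\<close> \<open>0 < \<delta>\<close> \<open>0 < c\<close>
    by (intro exI[of _ "\<delta> / c"]) (auto simp: porous_at_def)
qed

text \<open>
  The sets \<open>V k\<close> below have measure at most \<open>2\<^sup>-\<^sup>k * \<mu>(U)\<close>, so almost every point lies in finitely
  many of them; a point of the exceptional set that avoids \<open>V k\<close> for all \<open>k \<ge> m\<close> lies in the porous
  set \<open>P m\<close>.
\<close>

lemma AE_no_negligible_nearby_balls_on:
  fixes M :: "'a::{metric_space, second_countable_topology} measure"
  assumes borel: "sets M = sets borel"
    and null: "\<And>S. porous S \<Longrightarrow> measure_zero M S"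
    and "open U" and fin: "emeasure M U < \<infinity>" and \<delta>: "0 < \<delta>" "\<delta> \<le> 1"
  shows "AE x in M. x \<in> U \<longrightarrow> \<not> has_negligible_nearby_balls M \<delta> x"
proof -
  have "\<exists>V. open V \<and> emeasure M V \<le> ennreal ((1 / 2) ^ k) * emeasure M U \<and>
    (\<forall>x. x \<in> U \<longrightarrow> has_negligible_nearby_balls M \<delta> x \<longrightarrow>
       (\<exists>y d. 0 < d \<and> d < (1 / 2) ^ k \<and> ball y (\<delta> * d) \<subseteq> V \<and> dist y x < 7 * d))" for k :: nat
    by (rule ex_small_open_set_with_holes_near[OF borel \<open>open U\<close> \<delta>,
          of "(1 / 2) ^ k" "(1 / 2) ^ k"]) auto
  then obtain V where V: "\<And>k. open (V k)"
    "\<And>k. emeasure M (V k) \<le> ennreal ((1 / 2) ^ k) * emeasure M U"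
    "\<And>k x. x \<in> U \<Longrightarrow> has_negligible_nearby_balls M \<delta> x \<Longrightarrow>
       \<exists>y d. 0 < d \<and> d < (1 / 2) ^ k \<and> ball y (\<delta> * d) \<subseteq> V k \<and> dist y x < 7 * d"
    by metis
  define P where "P m = {x \<in> U. has_negligible_nearby_balls M \<delta> x \<and> (\<forall>k\<ge>m. x \<notin> V k)}" for m
  have "porous (P m)" for m
  proof (rule porousI[of \<delta> 7 "\<lambda>n. (1 / 2) ^ (n + m)"])
    show "(\<lambda>n. (1 / 2) ^ (n + m)) \<longlonglongrightarrow> (0 :: real)"
      by (rule LIMSEQ_ignore_initial_segment) (simp add: LIMSEQ_power_zero)
    fix x n assume "x \<in> P m"
    then obtain y d where yd: "0 < d" "d < (1 / 2) ^ (n + m)" "ball y (\<delta> * d) \<subseteq> V (n + m)"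
        "dist y x < 7 * d"
      using V(3)[of x "n + m"] by (auto simp: P_def)
    have "V (n + m) \<inter> P m = {}"
      by (auto simp: P_def)
    with yd show "\<exists>y d. 0 < d \<and> d < (1 / 2) ^ (n + m) \<and> ball y (\<delta> * d) \<inter> P m = {} \<and>
        dist y x < 7 * d"
      by blast
  qed (use \<delta> in auto)
  then have "AE x in M. x \<notin> P m" for m
    using null[of "P m"] unfolding measure_zero_def by (auto intro: AE_I')
  then have "AE x in M. \<forall>m. x \<notin> P m"
    by (simp add: AE_all_countable)
  moreover have "AE x in M. \<forall>\<^sub>F k in sequentially. x \<in> space M - V k"
  proof (rule borel_cantelli_AE1)
    have "ennreal ((1 / 2) ^ k) * emeasure M U = ennreal ((1 / 2) ^ k * measure M U)" for k :: nat
      using fin by (simp add: emeasure_eq_ennreal_measure ennreal_mult)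
    then have le: "emeasure M (V k) \<le> ennreal ((1 / 2) ^ k * measure M U)" for k
      using V(2)[of k] by simp
    then show finite: "emeasure M (V k) < \<infinity>" for k
      by (rule le_less_trans) simp
    have "measure M (V k) \<le> (1 / 2) ^ k * measure M U" for k
      using enn2real_leI[OF _ le[of k]] unfolding measure_def by simp
    then have le': "norm (measure M (V k)) \<le> (1 / 2) ^ k * measure M U" for k
      by simp
    have "summable (\<lambda>k. (1 / 2) ^ k * measure M U)"
      by (intro summable_mult2 summable_geometric) simp
    then show "summable (\<lambda>k. measure M (V k))"
      by (rule summable_comparison_test') (rule le')
  qed (simp add: borel V(1))
  ultimately show ?thesis
    by eventually_elim (auto simp: P_def eventually_sequentially)
qed

lemma AE_no_negligible_nearby_balls:
  fixes M :: "'a::polish_space measure"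
  assumes M: "metric_measure_space M"
    and null: "\<And>S. porous S \<Longrightarrow> measure_zero M S" and \<delta>: "0 < \<delta>" "\<delta> \<le> 1"
  shows "AE x in M. \<not> has_negligible_nearby_balls M \<delta> x"
proof -
  have borel: "sets M = sets borel"
    using M by (simp add: metric_measure_space_def)
  define \<U> where "\<U> = {U. open U \<and> emeasure M U < \<infinity>}"
  have cover: "\<Union>\<U> = UNIV"
  proof -
    have "x \<in> \<Union>\<U>" for x
    proof -
      obtain r where "0 < r" "emeasure M (ball x r) < \<infinity>"
        using M unfolding metric_measure_space_def by blast
      then show ?thesis
        by (intro UnionI[of "ball x r"]) (auto simp: \<U>_def)
    qed
    then show ?thesis
      by blast
  qed
  obtain \<U>' where \<U>': "\<U>' \<subseteq> \<U>" "countable \<U>'" "\<Union>\<U>' = \<Union>\<U>"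
    by (rule Lindelof[of \<U>]) (auto simp: \<U>_def)
  have "AE x in M. \<forall>U\<in>\<U>'. x \<in> U \<longrightarrow> \<not> has_negligible_nearby_balls M \<delta> x"
    using \<U>' \<delta>
    by (intro AE_ball_countable' AE_no_negligible_nearby_balls_on[OF borel null])
      (auto simp: \<U>_def)
  then show ?thesis
  proof eventually_elim
    case (elim x)
    have "x \<in> \<Union>\<U>'"
      by (simp add: \<U>'(3) cover)
    then obtain U where "U \<in> \<U>'" "x \<in> U"
      by (rule UnionE)
    with elim show ?case
      by blast
  qed
qed

section \<open>Lipschitz functions at a given point\<close>

text \<open>
  The choice \<open>(L + 1) * \<delta> \<le> \<epsilon> / 2\<close> makes the Lipschitz function vary by at most
  \<open>\<epsilon> * dist y x0 / 2\<close> on the small ball around \<open>y\<close>, and \<open>\<delta> < 1\<close> keeps this ball away from \<open>x0\<close> and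
  inside \<open>ball x0 (2 * dist y x0)\<close>.
\<close>

lemma aplim_zero_imp_lim_zero:
  fixes M :: "'a::polish_space measure" and g :: "'a \<Rightarrow> real"
  assumes M: "metric_measure_space M"
    and lip: "L-lipschitz_on UNIV g"
    and aplim: "has_aplim M (UNIV - {x0}) (\<lambda>x. g x / dist x x0) 0 x0"
    and regular: "\<And>n::nat. \<not> has_negligible_nearby_balls M (1 / (real n + 2)) x0"
  shows "((\<lambda>x. g x / dist x x0) \<longlongrightarrow> 0) (at x0)"
proof (rule ccontr)
  assume "\<not> ?thesis"
  then obtain \<epsilon> where \<epsilon>: "0 < \<epsilon>" and
      freq: "\<And>s. 0 < s \<Longrightarrow> \<exists>y. 0 < dist y x0 \<and> dist y x0 < s \<and> \<epsilon> \<le> \<bar>g y\<bar> / dist y x0"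
    unfolding tendsto_iff eventually_at by (force simp: not_less)
  have "0 \<le> L"
    using lip by (rule lipschitz_on_nonneg)
  obtain n :: nat where n: "2 * (L + 1) / \<epsilon> < real n"
    using reals_Archimedean2 by blast
  define \<delta> where "\<delta> = 1 / (real n + 2)"
  have \<delta>: "0 < \<delta>" "\<delta> < 1"
    by (auto simp: \<delta>_def)
  have "2 * (L + 1) \<le> \<epsilon> * (real n + 2)"
    using n \<epsilon> by (simp add: field_simps)
  then have L\<delta>: "L * \<delta> \<le> \<epsilon> / 2"
    using \<open>0 \<le> L\<close> by (simp add: \<delta>_def field_simps)
  have borel: "sets M = sets borel"
    using M by (simp add: metric_measure_space_def)
  obtain R where R: "0 < R" "emeasure M (ball x0 R) < \<infinity>"
    using M unfolding metric_measure_space_def by blast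
  define far where "far r = {x \<in> ball x0 r \<inter> (UNIV - {x0}). \<bar>g x / dist x x0 - 0\<bar> > \<epsilon> / 5}" for r
  have far_sets: "far r \<in> sets M" for r
  proof -
    have "continuous_on UNIV g"
      using lip by (rule lipschitz_on_continuous_on)
    then have [measurable]: "g \<in> borel_measurable borel"
      by (rule borel_measurable_continuous_onI)
    show ?thesis
      unfolding far_def borel by measurable
  qed
  have "has_negligible_nearby_balls M \<delta> x0"
    unfolding has_negligible_nearby_balls_def
  proof (intro allI impI)
    fix e s :: real assume "0 < e" "0 < s"
    have "((\<lambda>r. measure M (far r) / measure M (ball x0 r)) \<longlongrightarrow> 0) (at_right 0)"
      using aplim[unfolded has_aplim_def, rule_format, of "\<epsilon> / 5"] \<epsilon> by (simp add: far_def)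
    then have "\<forall>\<^sub>F r in at_right 0. measure M (far r) / measure M (ball x0 r) < e"
      using \<open>0 < e\<close> by (rule order_tendstoD)
    then obtain t where t: "0 < t" "\<And>r. 0 < r \<Longrightarrow> r < t \<Longrightarrow>
        measure M (far r) / measure M (ball x0 r) < e"
      by (auto simp: eventually_at_right_field)
    have "0 < min s (min t R / 2)"
      using \<open>0 < s\<close> t(1) R(1) by simp
    then obtain y where y: "0 < dist y x0" "dist y x0 < min s (min t R / 2)"
        "\<epsilon> \<le> \<bar>g y\<bar> / dist y x0"
      using freq by blast
    define d where "d = dist y x0"
    have d: "0 < d" "2 * d < t" "2 * d < R" "\<epsilon> * d \<le> \<bar>g y\<bar>"
      using y by (auto simp: d_def field_simps)
    have subset: "ball y (\<delta> * d) \<subseteq> far (2 * d)"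
    proof
      fix z assume "z \<in> ball y (\<delta> * d)"
      then have z: "dist y z < \<delta> * d"
        by simp
      moreover have "\<delta> * d < d"
        using \<delta> d(1) by simp
      ultimately have close: "dist y z < d"
        by linarith
      then have "z \<noteq> x0"
        by (auto simp: d_def)
      have dz: "dist x0 z < 2 * d"
        using close dist_triangle[of x0 z y] by (simp add: d_def dist_commute)
      have "\<bar>g y - g z\<bar> \<le> L * dist y z"
        using lipschitz_onD[OF lip, of y z] by (simp add: dist_real_def)
      also have "\<dots> \<le> L * (\<delta> * d)"
        using z \<open>0 \<le> L\<close> by (intro mult_left_mono) auto
      also have "\<dots> \<le> \<epsilon> / 2 * d"
        using mult_right_mono[OF L\<delta>, of d] d(1) by (simp add: mult.assoc)
      finally have "\<epsilon> / 2 * d \<le> \<bar>g z\<bar>"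
        using d(4) by linarith
      moreover have "\<epsilon> / 5 * dist z x0 < \<epsilon> / 5 * (2 * d)"
        using dz \<epsilon> by (intro mult_strict_left_mono) (auto simp: dist_commute)
      moreover have "\<epsilon> / 5 * (2 * d) \<le> \<epsilon> / 2 * d"
        using \<epsilon> d(1) by simp
      ultimately have "\<epsilon> / 5 * dist z x0 < \<bar>g z\<bar>"
        by linarith
      then have "\<epsilon> / 5 < \<bar>g z\<bar> / dist z x0"
        using \<open>z \<noteq> x0\<close> by (simp add: pos_less_divide_eq)
      then show "z \<in> far (2 * d)"
        using dz \<open>z \<noteq> x0\<close> by (simp add: far_def)
    qed
    have far_le: "far r \<subseteq> ball x0 r" for r
      by (auto simp: far_def)
    have "emeasure M (ball x0 (2 * d)) \<le> emeasure M (ball x0 R)"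
      using d(3) by (intro emeasure_mono) (auto simp: borel)
    then have fin: "emeasure M (ball x0 (2 * d)) < \<infinity>"
      using R(2) by (rule le_less_trans)
    have fm: "ball x0 (2 * d) \<in> fmeasurable M"
      using fin by (intro fmeasurableI) (auto simp: borel)
    have "measure M (far (2 * d)) \<le> e * measure M (ball x0 (2 * d))"
    proof (cases "measure M (ball x0 (2 * d)) = 0")
      case True
      then show ?thesis
        using measure_mono_fmeasurable[OF far_le far_sets fm] by simp
    next
      case False
      then have "0 < measure M (ball x0 (2 * d))"
        using measure_nonneg[of M] by (simp add: less_le)
      then show ?thesis
        using t(2)[of "2 * d"] d(1,2) by (simp add: field_simps)
    qed
    moreover have "emeasure M (far (2 * d)) = ennreal (measure M (far (2 * d)))"
      using fmeasurableI2[OF fm far_le far_sets] by (rule emeasure_eq_measure2)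
    moreover have "emeasure M (ball x0 (2 * d)) = ennreal (measure M (ball x0 (2 * d)))"
      using fm by (rule emeasure_eq_measure2)
    ultimately have "emeasure M (far (2 * d)) \<le> ennreal e * emeasure M (ball x0 (2 * d))"
      using \<open>0 < e\<close> by (simp flip: ennreal_mult)
    moreover have "emeasure M (ball y (\<delta> * d)) \<le> emeasure M (far (2 * d))"
      using subset far_sets by (rule emeasure_mono)
    ultimately show "\<exists>y. 0 < dist y x0 \<and> dist y x0 < s \<and>
        emeasure M (ball y (\<delta> * dist y x0)) \<le> ennreal e * emeasure M (ball x0 (2 * dist y x0))"
      using y by (intro exI[of _ y]) (auto simp: d_def)
  qed
  with regular[of n] show False
    by (simp add: \<delta>_def)
qed

theorem proposition2p8:
  fixes M :: "'a::polish_space measure"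
  assumes "metric_measure_space M"
    and "\<And>S. porous S \<Longrightarrow> measure_zero M S"
  shows "AE x0 in M. \<forall>g :: 'a \<Rightarrow> real.
           (\<exists>L. L-lipschitz_on UNIV g) \<longrightarrow>
           has_aplim M (UNIV - {x0}) (\<lambda>x. g x / dist x x0) 0 x0 \<longrightarrow>
           ((\<lambda>x. g x / dist x x0) \<longlongrightarrow> 0) (at x0)"
proof -
  have "AE x0 in M. \<forall>n::nat. \<not> has_negligible_nearby_balls M (1 / (real n + 2)) x0"
    unfolding AE_all_countable
    by (intro allI AE_no_negligible_nearby_balls[OF assms]) auto
  then show ?thesis
    by eventually_elim (blast intro: aplim_zero_imp_lim_zero[OF assms(1)])
qed

end
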